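(* Assume the setting described in the context. Let $\mathbf{x}=\mathbf{A}^{-1}\mathbf{b}$, let $\mathbf{x}^{\mathrm{prev}}\in\mathbb{R}^n$, and consider one iteration of the inV-cycle method starting from $\mathbf{x}^{\mathrm{prev}}$, with coarsest-level right-hand side $\mathbf{f}_0\neq\mathbf{0}$, exact coarsest-level solution $\mathbf{v}_0=\mathbf{A}_0^{-1}\mathbf{f}_0$ and computed coarsest-level approximation $\mathbf{v}_{0,\mathrm{in}}$. Let $\tau>0$ and assume that the relative residual stopping criterion $$\frac{\|\mathbf{f}_0-\mathbf{A}_0\mathbf{v}_{0,\mathrm{in}}\|}{\|\mathbf{f}_0\|}\le\tau$$ holds. Then $$\|\mathbf{v}_0-\mathbf{v}_{0,\mathrm{in}}\|_{\mathbf{A}_0}\le\gamma\,\|\mathbf{x}-\mathbf{x}^{\mathrm{prev}}\|_{\mathbf{A}}\qquad\text{with}\qquad\gamma=\tau\,\|\mathbf{T}\|\,\|\mathbf{A}\|^{1/2}\,\|\mathbf{A}_0^{-1}\|^{1/2},$$ where $\mathbf{T}$ is the matrix defined in the context.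
   Context: Setting. $\mathbf{A}\in\mathbb{R}^{n\times n}$ is symmetric positive definite (SPD) and $\mathbf{b}\in\mathbb{R}^n$. There are $J+1$ levels $0,\dots,J$ ($J\ge1$; level $0$ is the coarsest, level $J$ the finest), with system matrices $\mathbf{A}_j\in\mathbb{R}^{n_j\times n_j}$, $n_J=n$, $\mathbf{A}_J=\mathbf{A}$, and prolongation matrices $\mathbf{P}_j\in\mathbb{R}^{n_j\times n_{j-1}}$, $j=1,\dots,J$, of full (column) rank, satisfying the Galerkin condition $\mathbf{A}_{j-1}=\mathbf{P}_j^\top\mathbf{A}_j\mathbf{P}_j$ for $j=1,\dots,J$ (so all $\mathbf{A}_j$ are SPD). $\mathbf{I}_j\in\mathbb{R}^{n_j\times n_j}$ is the identity. Norms. $\|\cdot\|$ is the Euclidean vector norm and the induced (spectral) matrix norm; $\|\mathbf{v}\|_{\mathbf{A}_j}=\|\mathbf{A}_j^{1/2}\mathbf{v}\|$, and the same symbol denotes the induced matrix norm. Smoothers. $\mathbf{M}_j,\mathbf{N}_j\in\mathbb{R}^{n_j\times n_j}$, $j=1,\dots,J$, are non-singular matrices (not necessarily symmetric) with $\|\mathbf{I}_j-\mathbf{M}_j\mathbf{A}_j\|_{\mathbf{A}_j}<1$ and $\|\mathbf{I}_j-\mathbf{N}_j\mathbf{A}_j\|_{\mathbf{A}_j}<1$. Also allowed: no pre-smoothing (all $\mathbf{M}_j=\mathbf{0}$, with the $\mathbf{N}_j$ non-singular and satisfying $\|\mathbf{I}_j-\mathbf{N}_j\mathbf{A}_j\|_{\mathbf{A}_j}<1$)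 or no post-smoothing (all $\mathbf{N}_j=\mathbf{0}$, with the $\mathbf{M}_j$ non-singular and satisfying $\|\mathbf{I}_j-\mathbf{M}_j\mathbf{A}_j\|_{\mathbf{A}_j}<1$). V-cycle. One iteration maps $\mathbf{x}^{\mathrm{prev}}$ to $\mathbf{x}^{\mathrm{new}}=\mathbf{V}(\mathbf{b},\mathbf{x}^{\mathrm{prev}},J)$, where $\mathbf{V}(\mathbf{f}_j,\mathbf{v}_j^{[0]},j)$ is defined recursively. For $j\ne0$: $\mathbf{v}_j^{[1]}=\mathbf{v}_j^{[0]}+\mathbf{M}_j(\mathbf{f}_j-\mathbf{A}_j\mathbf{v}_j^{[0]})$; $\mathbf{f}_{j-1}=\mathbf{P}_j^\top(\mathbf{f}_j-\mathbf{A}_j\mathbf{v}_j^{[1]})$; $\mathbf{v}_{j-1}^{[2]}=\mathbf{V}(\mathbf{f}_{j-1},\mathbf{0},j-1)$; $\mathbf{v}_j^{[3]}=\mathbf{v}_j^{[1]}+\mathbf{P}_j\mathbf{v}_{j-1}^{[2]}$; $\mathbf{v}_j^{[4]}=\mathbf{v}_j^{[3]}+\mathbf{N}_j(\mathbf{f}_j-\mathbf{A}_j\mathbf{v}_j^{[3]})$; return $\mathbf{v}_j^{[4]}$. For $j=0$, in the inV-cycle method: return an approximation $\mathbf{v}_{0,\mathrm{in}}\in\mathbb{R}^{n_0}$, computed by an arbitrary solver, to the solution $\mathbf{v}_0$ of $\mathbf{A}_0\mathbf{v}_0=\mathbf{f}_0$. All other computations are exact. Matrix $\mathbf{T}$.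 $\mathbf{T}=\prod_{j=1}^{J}\mathbf{P}_j^\top(\mathbf{I}_j-\mathbf{A}_j\mathbf{M}_j)=\mathbf{P}_1^\top(\mathbf{I}_1-\mathbf{A}_1\mathbf{M}_1)\,\mathbf{P}_2^\top(\mathbf{I}_2-\mathbf{A}_2\mathbf{M}_2)\cdots\mathbf{P}_J^\top(\mathbf{I}_J-\mathbf{A}_J\mathbf{M}_J)\in\mathbb{R}^{n_0\times n_J}$ (factors ordered with $j=1$ leftmost). *)

theory Defs
  imports
    Complex_Main
    "Jordan_Normal_Form.Gauss_Jordan_Elimination"
    "Jordan_Normal_Form.DL_Rank"
begin

definition euclid_norm :: "real vec \<Rightarrow> real" where
  "euclid_norm v = sqrt (v \<bullet> v)"

text \<open>
  Operator norm induced by a vector norm on the domain and a vector norm on the codomain.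
  The supremum is over an empty set (hence unspecified) for matrices without columns.
\<close>

definition induced_norm :: "(real vec \<Rightarrow> real) \<Rightarrow> (real vec \<Rightarrow> real) \<Rightarrow> real mat \<Rightarrow> real" where
  "induced_norm dom_norm cod_norm B =
     (SUP v\<in>{v \<in> carrier_vec (dim_col B). v \<noteq> 0\<^sub>v (dim_col B)}.
        cod_norm (B *\<^sub>v v) / dom_norm v)"

definition spectral_norm :: "real mat \<Rightarrow> real" where
  "spectral_norm = induced_norm euclid_norm euclid_norm"

definition spd :: "real mat \<Rightarrow> bool" where
  "spd A \<longleftrightarrow> square_mat A \<and> transpose_mat A = A \<and>
     (\<forall>v\<in>carrier_vec (dim_row A). v \<noteq> 0\<^sub>v (dim_row A) \<longrightarrow> v \<bullet> (A *\<^sub>v v) > 0)"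

text \<open>
  The matrix square root and the inverse are only meaningful for symmetric positive definite
  and for invertible arguments, respectively.
\<close>

definition mat_sqrt :: "real mat \<Rightarrow> real mat" where
  "mat_sqrt A = (THE B. spd B \<and> B * B = A)"

abbreviation mat_inv :: "real mat \<Rightarrow> real mat" where
  "mat_inv A \<equiv> the (mat_inverse A)"

definition energy_norm :: "real mat \<Rightarrow> real vec \<Rightarrow> real" where
  "energy_norm A v = euclid_norm (mat_sqrt A *\<^sub>v v)"

definition energy_mat_norm :: "real mat \<Rightarrow> real mat \<Rightarrow> real" where
  "energy_mat_norm A = induced_norm (energy_norm A) (energy_norm A)"

definition convergent_smoother :: "real mat \<Rightarrow> real mat \<Rightarrow> bool" where
  "convergent_smoother A B \<longleftrightarrow>
     B \<in> carrier_mat (dim_row A) (dim_row A) \<and> invertible_mat B \<and>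
     energy_mat_norm A (1\<^sub>m (dim_row A) - B * A) < 1"

text \<open>
  The term \<open>inV_cycle A P M N j f v f0 v0in w\<close> says that a call of the V-cycle on level \<open>j\<close>
  with right-hand side \<open>f\<close> and initial approximation \<open>v\<close> returns \<open>w\<close>, where \<open>f0\<close> is the
  right-hand side passed down to the coarsest level and \<open>v0in\<close> is the vector returned there.
  It is a relation rather than a function because the coarsest-level solver is arbitrary.
\<close>

inductive inV_cycle ::
  "(nat \<Rightarrow> real mat) \<Rightarrow> (nat \<Rightarrow> real mat) \<Rightarrow> (nat \<Rightarrow> real mat) \<Rightarrow> (nat \<Rightarrow> real mat) \<Rightarrow>
   nat \<Rightarrow> real vec \<Rightarrow> real vec \<Rightarrow> real vec \<Rightarrow> real vec \<Rightarrow> real vec \<Rightarrow> bool"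
  for A P M N where
  coarsest:
    "v0in \<in> carrier_vec (dim_row (A 0)) \<Longrightarrow> inV_cycle A P M N 0 f v f v0in v0in"
| level:
    "v1 = v + M (Suc j) *\<^sub>v (f - A (Suc j) *\<^sub>v v) \<Longrightarrow>
     f' = transpose_mat (P (Suc j)) *\<^sub>v (f - A (Suc j) *\<^sub>v v1) \<Longrightarrow>
     inV_cycle A P M N j f' (0\<^sub>v (dim_row (A j))) f0 v0in v2 \<Longrightarrow>
     v3 = v1 + P (Suc j) *\<^sub>v v2 \<Longrightarrow>
     v4 = v3 + N (Suc j) *\<^sub>v (f - A (Suc j) *\<^sub>v v3) \<Longrightarrow>
     inV_cycle A P M N (Suc j) f v f0 v0in v4"

fun T_mat :: "(nat \<Rightarrow> real mat) \<Rightarrow> (nat \<Rightarrow> real mat) \<Rightarrow> (nat \<Rightarrow> real mat) \<Rightarrow> nat \<Rightarrow> real mat" where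
  "T_mat A P M 0 = 1\<^sub>m (dim_row (A 0))"
| "T_mat A P M (Suc j) =
     T_mat A P M j *
       (transpose_mat (P (Suc j)) * (1\<^sub>m (dim_row (A (Suc j))) - A (Suc j) * M (Suc j)))"

end

theory Submission
  imports Defs "Jordan_Normal_Form.Schur_Decomposition"
begin

text \<open>
  Since \<open>A x = b\<close>, the right-hand side that reaches the coarsest level is
  \<open>f\<^sub>0 = T (b - A x\<^sup>p\<^sup>r\<^sup>e\<^sup>v) = T A (x - x\<^sup>p\<^sup>r\<^sup>e\<^sup>v)\<close>, hence
  \<open>\<parallel>f\<^sub>0\<parallel> \<le> \<parallel>T\<parallel> \<parallel>A\<parallel>\<^sup>1\<^sup>/\<^sup>2 \<parallel>x - x\<^sup>p\<^sup>r\<^sup>e\<^sup>v\<parallel>\<^sub>A\<close>. On the coarsest level the energy norm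
  of the error is at most \<open>\<parallel>A\<^sub>0\<^sup>-\<^sup>1\<parallel>\<^sup>1\<^sup>/\<^sup>2\<close> times the norm of the residual, which the stopping
  criterion bounds by \<open>\<tau> \<parallel>f\<^sub>0\<parallel>\<close>. The energy norm is defined by the square root of a matrix, so its
  identity \<open>\<parallel>v\<parallel>\<^sub>A\<^sup>2 = v \<bullet> A v\<close> needs existence and uniqueness of that root, which follow from the
  spectral theorem for real symmetric matrices.
\<close>

section \<open>Real scalar products and the spectral theorem for symmetric matrices\<close>

lemma symmetric_scalar_prod_mult_mat_vec:
  fixes A :: "'a :: comm_semiring_0 mat"
  assumes "A \<in> carrier_mat n n" "transpose_mat A = A" "v \<in> carrier_vec n" "w \<in> carrier_vec n"
  shows "(A *\<^sub>v v) \<bullet> w = v \<bullet> (A *\<^sub>v w)"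
  using transpose_vec_mult_scalar[of A n n w v] assms
  by (metis comm_scalar_prod mult_mat_vec_carrier)

lemma scalar_prod_self_eq_0:
  fixes v :: "real vec"
  assumes "v \<in> carrier_vec n"
  shows "v \<bullet> v = 0 \<longleftrightarrow> v = 0\<^sub>v n"
  using conjugate_square_eq_0_vec[OF assms] by simp

lemma scalar_prod_self_nonneg: "v \<bullet> v \<ge> 0" for v :: "real vec"
  by (simp add: scalar_prod_def sum_nonneg)

lemma scalar_prod_self_pos:
  fixes v :: "real vec"
  assumes "v \<in> carrier_vec n" "v \<noteq> 0\<^sub>v n"
  shows "v \<bullet> v > 0"
  using scalar_prod_self_nonneg[of v] scalar_prod_self_eq_0[OF assms(1)] assms(2) by force

text \<open>The complexified matrix has an eigenpair \<open>(c, z)\<close> by the fundamental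
  theorem of algebra. Splitting \<open>z\<close> into real and imaginary parts gives two coupled
  real equations; symmetry forces \<open>c\<close> to be real, and then every non-zero part of
  \<open>z\<close> is a real eigenvector.\<close>

lemma symmetric_real_eigenvector:
  fixes A :: "real mat"
  assumes A: "A \<in> carrier_mat n n" and sym: "transpose_mat A = A" and n: "n > 0"
  obtains v e where "v \<in> carrier_vec n" "v \<noteq> 0\<^sub>v n" "A *\<^sub>v v = e \<cdot>\<^sub>v v"
proof -
  define C where "C = map_mat complex_of_real A"
  have C: "C \<in> carrier_mat n n" using A by (auto simp: C_def)
  have "degree (char_poly C) = n" using degree_monic_char_poly[OF C] by simp
  then have "\<not> constant (poly (char_poly C))" using n by (simp add: constant_degree)
  then obtain c where "poly (char_poly C) c = 0"
    using fundamental_theorem_of_algebra by blast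
  then have "eigenvalue C c" using eigenvalue_root_char_poly[OF C] by simp
  then obtain z where z: "z \<in> carrier_vec n" "z \<noteq> 0\<^sub>v n" "C *\<^sub>v z = c \<cdot>\<^sub>v z"
    using C unfolding eigenvalue_def eigenvector_def by auto
  define x where "x = map_vec Re z"
  define y where "y = map_vec Im z"
  have x: "x \<in> carrier_vec n" and y: "y \<in> carrier_vec n" using z by (auto simp: x_def y_def)
  \<comment> \<open>The eigenvector equation in coordinates, with the real entries of
    \<open>A\<close> made explicit, so that \<open>Re\<close> and \<open>Im\<close> can be taken on
    both sides.\<close>
  have idx: "(\<Sum>j<n. complex_of_real (A $$ (i, j)) * z $ j) = c * z $ i" if "i < n" for i
    using arg_cong[OF z(3), of "\<lambda>w. w $ i"] that A C z(1)
    by (simp add: scalar_prod_def C_def row_def atLeast0LessThan)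
  have Ax: "A *\<^sub>v x = Re c \<cdot>\<^sub>v x - Im c \<cdot>\<^sub>v y"
  proof (rule eq_vecI)
    fix i assume "i < dim_vec (Re c \<cdot>\<^sub>v x - Im c \<cdot>\<^sub>v y)"
    then have i: "i < n" using y by simp
    show "(A *\<^sub>v x) $ i = (Re c \<cdot>\<^sub>v x - Im c \<cdot>\<^sub>v y) $ i"
      using arg_cong[OF idx[OF i], of Re] i A x y z(1)
      by (simp add: scalar_prod_def row_def atLeast0LessThan x_def y_def)
  qed (use A x y in auto)
  have Ay: "A *\<^sub>v y = Im c \<cdot>\<^sub>v x + Re c \<cdot>\<^sub>v y"
  proof (rule eq_vecI)
    fix i assume "i < dim_vec (Im c \<cdot>\<^sub>v x + Re c \<cdot>\<^sub>v y)"
    then have i: "i < n" using y by simp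
    show "(A *\<^sub>v y) $ i = (Im c \<cdot>\<^sub>v x + Re c \<cdot>\<^sub>v y) $ i"
      using arg_cong[OF idx[OF i], of Im] i A x y z(1)
      by (simp add: scalar_prod_def row_def atLeast0LessThan x_def y_def add.commute)
  qed (use A x y in auto)
  have "x \<noteq> 0\<^sub>v n \<or> y \<noteq> 0\<^sub>v n"
  proof (rule ccontr)
    assume "\<not> ?thesis"
    then have "z $ i = 0" if "i < n" for i
      using that z(1) unfolding x_def y_def
      by (metis Re_complex_of_real carrier_vecD complex_eqI complex_Re_of_int index_map_vec(1)
          index_zero_vec(1) zero_complex.simps)
    then have "z = 0\<^sub>v n" using z(1) by (intro eq_vecI) auto
    with z(2) show False by simp
  qed
  \<comment> \<open>By symmetry \<open>x \<bullet> A y = y \<bullet> A x\<close>; inserting the two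
    real equations, the \<open>Re c\<close> terms cancel and
    \<open>Im c * (x \<bullet> x + y \<bullet> y) = 0\<close> remains.\<close>
  moreover have "Im c = 0"
  proof -
    have xAy: "x \<bullet> (A *\<^sub>v y) = Im c * (x \<bullet> x) + Re c * (x \<bullet> y)"
      unfolding Ay using x y by (simp add: scalar_prod_add_distrib[of _ n])
    have yAx: "y \<bullet> (A *\<^sub>v x) = Re c * (y \<bullet> x) - Im c * (y \<bullet> y)"
      unfolding Ax using x y by (simp add: scalar_prod_minus_distrib[of _ n])
    have "x \<bullet> (A *\<^sub>v y) = y \<bullet> (A *\<^sub>v x)"
      using symmetric_scalar_prod_mult_mat_vec[OF A sym x y] A x y
      by (metis comm_scalar_prod mult_mat_vec_carrier)
    then have "Im c * (x \<bullet> x + y \<bullet> y) = 0"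
      unfolding xAy yAx using comm_scalar_prod[OF x y] by (simp add: algebra_simps)
    moreover have "x \<bullet> x + y \<bullet> y > 0"
      using \<open>x \<noteq> 0\<^sub>v n \<or> y \<noteq> 0\<^sub>v n\<close> scalar_prod_self_pos[OF x] scalar_prod_self_pos[OF y]
        scalar_prod_self_nonneg[of x] scalar_prod_self_nonneg[of y] by linarith
    ultimately show ?thesis by simp
  qed
  moreover have "A *\<^sub>v x = Re c \<cdot>\<^sub>v x" "A *\<^sub>v y = Re c \<cdot>\<^sub>v y" if "Im c = 0"
    unfolding Ax Ay that using x y by (auto intro!: eq_vecI)
  ultimately show thesis
    using that x y by blast
qed

text \<open>Gram-Schmidt on a basis completing \<open>v\<close> leaves its first vector unchanged,
  and normalising the results gives the columns of \<open>W\<close>. This is the change of basis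
  that splits off one eigenvector in the spectral theorem.\<close>

lemma orthogonal_mat_with_first_column:
  fixes v :: "real vec"
  assumes v: "v \<in> carrier_vec n" and v1: "v \<bullet> v = 1" and n: "n > 0"
  obtains W where "W \<in> carrier_mat n n" "transpose_mat W * W = 1\<^sub>m n" "col W 0 = v"
proof -
  interpret cof_vec_space n "TYPE(real)" .
  have v0: "v \<noteq> 0\<^sub>v n" using v1 v by auto
  define b where "b = basis_completion v"
  define ws where "ws = gram_schmidt n b"
  note bc = basis_completion[OF v v0, folded b_def]
  obtain vs where bv: "b = v # vs" using bc(6,7) n by (cases b) auto
  note gs = gram_schmidt_result[OF bc(2) bc(4) bc(5) refl, folded ws_def]
  have hd: "ws ! 0 = v"
    using gram_schmidt_hd[OF v, of vs, folded bv] gs(4) bc(6) n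
    by (metis ws_def hd_conv_nth length_0_conv not_less0)
  have len: "length ws = n" using gs(4) bc(6) by simp
  define us where "us = map (\<lambda>w. (1 / sqrt (w \<bullet> w)) \<cdot>\<^sub>v w) ws"
  define W where "W = mat_of_cols n us"
  have wsc: "ws ! i \<in> carrier_vec n" if "i < n" for i using that len gs(3) by auto
  have W: "W \<in> carrier_mat n n" by (simp add: W_def us_def len carrier_matI)
  have colW: "col W i = (1 / sqrt (ws ! i \<bullet> ws ! i)) \<cdot>\<^sub>v ws ! i" if "i < n" for i
    unfolding W_def us_def using that len wsc by (subst col_mat_of_cols) auto
  have "transpose_mat W * W = 1\<^sub>m n"
  proof (rule eq_matI)
    fix i j assume "i < dim_row (1\<^sub>m n :: real mat)" "j < dim_col (1\<^sub>m n :: real mat)"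
    then have ij: "i < n" "j < n" by auto
    have "(transpose_mat W * W) $$ (i, j) = col W i \<bullet> col W j" using W ij by simp
    also have "\<dots> = (ws ! i \<bullet> ws ! j) / (sqrt (ws ! i \<bullet> ws ! i) * sqrt (ws ! j \<bullet> ws ! j))"
      unfolding colW[OF ij(1)] colW[OF ij(2)] using wsc[OF ij(1)] wsc[OF ij(2)] by simp
    also have "\<dots> = (if i = j then 1 else 0)"
      using corthogonalD[OF gs(2), of i j] corthogonalD[OF gs(2), of i i] ij len
        scalar_prod_self_nonneg[of "ws ! i"] by auto
    finally show "(transpose_mat W * W) $$ (i, j) = 1\<^sub>m n $$ (i, j)" using ij by simp
  qed (use W in auto)
  moreover have "col W 0 = v" using colW[OF n] hd v1 v by simp
  ultimately show thesis using that W by blast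
qed

lemma mult_mat_zero_vec:
  fixes A :: "'a :: semiring_0 mat"
  assumes "A \<in> carrier_mat m n"
  shows "A *\<^sub>v 0\<^sub>v n = 0\<^sub>v m"
  using assms by (intro eq_vecI) (auto intro!: scalar_prod_right_zero)

text \<open>Deflation, by induction on the dimension: in an orthonormal basis starting with a unit
  eigenvector, the matrix is block diagonal with the eigenvalue in the corner, and the remaining
  symmetric block is diagonalised by the induction hypothesis.\<close>

lemma real_spectral_theorem:
  fixes A :: "real mat"
  assumes "A \<in> carrier_mat n n" "transpose_mat A = A"
  shows "\<exists>U d. U \<in> carrier_mat n n \<and> transpose_mat U * U = 1\<^sub>m n \<and> U * transpose_mat U = 1\<^sub>m n \<and>
    A = U * mat_diag n d * transpose_mat U"
  using assms
proof (induction n arbitrary: A)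
  case 0
  then show ?case by (intro exI[of _ "1\<^sub>m 0"] exI[of _ "\<lambda>_. 0"]) auto
next
  case (Suc n)
  note A = Suc.prems(1) and sym = Suc.prems(2)
  obtain v0 e where v0: "v0 \<in> carrier_vec (Suc n)" "v0 \<noteq> 0\<^sub>v (Suc n)" "A *\<^sub>v v0 = e \<cdot>\<^sub>v v0"
    using symmetric_real_eigenvector[OF A sym] by auto
  define v where "v = (1 / sqrt (v0 \<bullet> v0)) \<cdot>\<^sub>v v0"
  have v: "v \<in> carrier_vec (Suc n)" using v0 by (simp add: v_def)
  have vv: "v \<bullet> v = 1"
    using scalar_prod_self_pos[OF v0(1,2)] v0(1) by (simp add: v_def)
  have Av: "A *\<^sub>v v = e \<cdot>\<^sub>v v"
    unfolding v_def using A v0 by (simp add: mult_mat_vec smult_smult_assoc mult.commute)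
  obtain W where W: "W \<in> carrier_mat (Suc n) (Suc n)" "transpose_mat W * W = 1\<^sub>m (Suc n)"
    "col W 0 = v"
    using orthogonal_mat_with_first_column[OF v vv] by auto
  have WW: "W * transpose_mat W = 1\<^sub>m (Suc n)"
    using mat_mult_left_right_inverse[of "transpose_mat W" "Suc n" W] W by auto
  define B where "B = transpose_mat W * A * W"
  have B: "B \<in> carrier_mat (Suc n) (Suc n)" using A W by (simp add: B_def)
  have symB: "transpose_mat B = B"
    unfolding B_def using A W sym by (simp add: transpose_mult[of _ "Suc n" "Suc n" _ "Suc n"])
  have A_eq: "A = W * B * transpose_mat W"
  proof -
    have "W * B * transpose_mat W = (W * transpose_mat W) * A * (W * transpose_mat W)"
      unfolding B_def using A W by (simp add: assoc_mult_mat[of _ "Suc n" "Suc n" _ "Suc n" _ "Suc n"])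
    then show ?thesis using WW A by simp
  qed
  \<comment> \<open>The first column of \<open>W\<close> is the eigenvector \<open>v\<close>, so
    column 0 of \<open>B\<close> is \<open>e\<close> times column 0 of
    \<open>transpose_mat W * W\<close>, the identity. Row 0 then follows by symmetry.\<close>
  have col0: "B $$ (i, 0) = (if i = 0 then e else 0)" if "i < Suc n" for i
  proof -
    have "B $$ (i, 0) = (transpose_mat W * (A * W)) $$ (i, 0)"
      unfolding B_def using A W by (simp add: assoc_mult_mat[of _ "Suc n" "Suc n" _ "Suc n" _ "Suc n"])
    also have "\<dots> = col W i \<bullet> col (A * W) 0" using that A W by simp
    also have "col (A * W) 0 = A *\<^sub>v v" unfolding W(3)[symmetric] using A W(1) by (rule col_mult2) simp
    also have "col W i \<bullet> (A *\<^sub>v v) = e * (col W i \<bullet> col W 0)" unfolding Av using W that v by simp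
    also have "col W i \<bullet> col W 0 = (transpose_mat W * W) $$ (i, 0)" using W(1) that by simp
    finally show ?thesis using W(2) that by simp
  qed
  have row0: "B $$ (0, i) = (if i = 0 then e else 0)" if "i < Suc n" for i
    using col0[OF that] arg_cong[OF symB, of "\<lambda>M. M $$ (0, i)"] B that by simp
  define A' where "A' = mat n n (\<lambda>(i, j). B $$ (Suc i, Suc j))"
  have A': "A' \<in> carrier_mat n n" by (simp add: A'_def)
  have "transpose_mat A' = A'"
  proof (rule eq_matI)
    fix i j assume "i < dim_row A'" "j < dim_col A'"
    then show "transpose_mat A' $$ (i, j) = A' $$ (i, j)"
      using arg_cong[OF symB, of "\<lambda>M. M $$ (Suc i, Suc j)"] B by (simp add: A'_def)
  qed (auto simp: A'_def)
  from Suc.IH[OF A' this] obtain U d where U: "U \<in> carrier_mat n n"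
    "transpose_mat U * U = 1\<^sub>m n" "U * transpose_mat U = 1\<^sub>m n"
    and A'_eq: "A' = U * mat_diag n d * transpose_mat U" by blast
  \<comment> \<open>\<open>F\<close> borders the orthogonal matrix of the smaller block by a 1, and
    \<open>case_nat e d\<close> puts \<open>e\<close> in front of the eigenvalues of that block.
    Then \<open>B = F * D * transpose_mat F\<close>, and \<open>W * F\<close> diagonalises
    \<open>A\<close>.\<close>
  define F where "F = four_block_mat (1\<^sub>m 1) (0\<^sub>m 1 n) (0\<^sub>m n 1) U"
  define D where "D = mat_diag (Suc n) (case_nat e d)"
  have F: "F \<in> carrier_mat (Suc n) (Suc n)" using U unfolding F_def
    using four_block_carrier_mat[of "1\<^sub>m 1" 1 1 U n n] by simp
  have FT: "transpose_mat F = four_block_mat (1\<^sub>m 1) (0\<^sub>m 1 n) (0\<^sub>m n 1) (transpose_mat U)"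
    unfolding F_def using U by (subst transpose_four_block_mat) auto
  have D: "D = four_block_mat (mat 1 1 (\<lambda>_. e)) (0\<^sub>m 1 n) (0\<^sub>m n 1) (mat_diag n d)"
    unfolding D_def by (rule eq_matI) (auto simp: mat_diag_def split: nat.split)
  have one: "four_block_mat (1\<^sub>m 1) (0\<^sub>m 1 n) (0\<^sub>m n 1) (1\<^sub>m n) = (1\<^sub>m (Suc n) :: real mat)"
    by (rule eq_matI) auto
  have FF: "transpose_mat F * F = 1\<^sub>m (Suc n)" "F * transpose_mat F = 1\<^sub>m (Suc n)"
    unfolding FT unfolding F_def using U one
    by (simp_all add: mult_four_block_mat[of _ 1 1 _ n _ n _ _ 1 _ n])
  have UD: "U * mat_diag n d \<in> carrier_mat n n" using U(1) by (rule mult_carrier_mat) simp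
  have UDU: "U * mat_diag n d * transpose_mat U \<in> carrier_mat n n"
    using UD by (rule mult_carrier_mat) (use U in simp)
  have "B = four_block_mat (mat 1 1 (\<lambda>_. e)) (0\<^sub>m 1 n) (0\<^sub>m n 1) A'"
    by (rule eq_matI) (use B col0 row0 in \<open>auto simp: A'_def\<close>)
  also have "\<dots> = F * D * transpose_mat F"
    unfolding FT unfolding F_def D A'_eq using U
    by (simp add: mult_four_block_mat[of _ 1 1 _ n _ n _ _ 1 _ n] left_mult_zero_mat[OF mat_diag_dim]
        right_mult_zero_mat[OF UD] left_add_zero_mat[OF UDU])
  finally have B_eq: "B = F * D * transpose_mat F" .
  have Dc: "D \<in> carrier_mat (Suc n) (Suc n)" by (simp add: D_def)
  note assoc = assoc_mult_mat[of _ "Suc n" "Suc n" _ "Suc n" _ "Suc n"]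
  have T: "transpose_mat (W * F) = transpose_mat F * transpose_mat W"
    using W F by (simp add: transpose_mult)
  have "transpose_mat (W * F) * (W * F) = transpose_mat F * (transpose_mat W * W) * F"
    unfolding T using W(1) F by (simp add: assoc)
  then have 1: "transpose_mat (W * F) * (W * F) = 1\<^sub>m (Suc n)" using W F FF by simp
  have "(W * F) * transpose_mat (W * F) = W * (F * transpose_mat F) * transpose_mat W"
    unfolding T using W(1) F by (simp add: assoc)
  then have 2: "(W * F) * transpose_mat (W * F) = 1\<^sub>m (Suc n)" using W F FF WW by simp
  have 3: "A = (W * F) * D * transpose_mat (W * F)"
    unfolding T using A_eq[unfolded B_eq] W F Dc by (simp add: assoc)
  show ?case
    using 1 2 3 W F unfolding D_def
    by (intro exI[of _ "W * F"] exI[of _ "case_nat e d"]) auto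
qed

section \<open>Existence and uniqueness of the positive definite square root\<close>

lemma scalar_prod_mat_diag:
  fixes v :: "'a :: comm_semiring_0 vec"
  assumes "v \<in> carrier_vec n"
  shows "v \<bullet> (mat_diag n d *\<^sub>v v) = (\<Sum>i<n. d i * (v $ i * v $ i))"
proof -
  have D: "dim_row (mat_diag n d) = n" by (simp add: mat_diag_def)
  have "(mat_diag n d *\<^sub>v v) $ i = d i * v $ i" if "i < n" for i
  proof -
    have "(mat_diag n d *\<^sub>v v) $ i = (\<Sum>j<n. (if i = j then d j else 0) * v $ j)"
      using that assms D by (simp add: mat_diag_def scalar_prod_def atLeast0LessThan)
    also have "\<dots> = (\<Sum>j<n. if j = i then d i * v $ i else 0)" by (rule sum.cong) auto
    finally have "(mat_diag n d *\<^sub>v v) $ i = (\<Sum>j<n. if j = i then d i * v $ i else 0)" .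
    then show ?thesis using that by simp
  qed
  then show ?thesis using assms D
    unfolding scalar_prod_def[of v] by (auto simp: atLeast0LessThan ac_simps intro!: sum.cong)
qed

lemma orthogonal_mat_col:
  fixes U :: "real mat"
  assumes U: "U \<in> carrier_mat n n" "transpose_mat U * U = 1\<^sub>m n" and k: "k < n"
  shows "col U k \<in> carrier_vec n" "transpose_mat U *\<^sub>v col U k = unit_vec n k" "col U k \<noteq> 0\<^sub>v n"
proof -
  show u: "col U k \<in> carrier_vec n" using U k by auto
  have "transpose_mat U *\<^sub>v col U k = col (transpose_mat U * U) k"
    using U(1) k col_mult2[of "transpose_mat U" n n U n] by simp
  then show Uu: "transpose_mat U *\<^sub>v col U k = unit_vec n k" using U k by simp
  show "col U k \<noteq> 0\<^sub>v n"
  proof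
    assume "col U k = 0\<^sub>v n"
    then have "unit_vec n k = (0\<^sub>v n :: real vec)"
      using Uu U mult_mat_zero_vec[of "transpose_mat U" n n] by simp
    then have "unit_vec n k $ k = (0\<^sub>v n :: real vec) $ k" by simp
    then show False using k by simp
  qed
qed

text \<open>The eigenvalues of \<open>A\<close> are positive, so the root is obtained by taking
  their square roots in the same orthonormal eigenbasis.\<close>

lemma spd_sqrt_exists:
  assumes A: "A \<in> carrier_mat n n" and spd: "spd A"
  shows "\<exists>S. S \<in> carrier_mat n n \<and> spd S \<and> S * S = A"
proof -
  have sym: "transpose_mat A = A" using spd by (simp add: spd_def)
  obtain U d where U: "U \<in> carrier_mat n n" "transpose_mat U * U = 1\<^sub>m n" "U * transpose_mat U = 1\<^sub>m n"
    and A_eq: "A = U * mat_diag n d * transpose_mat U"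
    using real_spectral_theorem[OF A sym] by blast
  note assoc = assoc_mult_mat[of _ n n _ n _ n]
  \<comment> \<open>Stated for an arbitrary diagonal \<open>f\<close>, because it is used twice:
    with the eigenvalues \<open>d\<close>, to show them positive, and with their roots, to show
    \<open>S\<close> positive definite.\<close>
  have quad: "v \<bullet> ((U * mat_diag n f * transpose_mat U) *\<^sub>v v) =
      (\<Sum>i<n. f i * ((transpose_mat U *\<^sub>v v) $ i * (transpose_mat U *\<^sub>v v) $ i))"
    if v: "v \<in> carrier_vec n" for f v
  proof -
    let ?w = "transpose_mat U *\<^sub>v v"
    have w: "?w \<in> carrier_vec n" using U v by simp
    have "v \<bullet> ((U * mat_diag n f * transpose_mat U) *\<^sub>v v) = v \<bullet> (U *\<^sub>v (mat_diag n f *\<^sub>v ?w))"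
      using U v by (simp add: assoc_mult_mat_vec[of _ n n _ n])
    also have "\<dots> = ?w \<bullet> (mat_diag n f *\<^sub>v ?w)"
      using transpose_vec_mult_scalar[of "U" n n "mat_diag n f *\<^sub>v ?w" v] U v mult_mat_vec_carrier[OF mat_diag_dim w]
      by simp
    finally show ?thesis using scalar_prod_mat_diag[OF w] by simp
  qed
  \<comment> \<open>The quadratic form of \<open>A\<close> at the \<open>k\<close>-th column of
    \<open>U\<close> is exactly \<open>d k\<close>, since \<open>transpose_mat U\<close> maps this
    column to a unit vector.\<close>
  have d_pos: "d k > 0" if k: "k < n" for k
  proof -
    let ?u = "col U k"
    note u = orthogonal_mat_col(1)[OF U(1,2) k] and Uu = orthogonal_mat_col(2)[OF U(1,2) k]
    have "0 < ?u \<bullet> (A *\<^sub>v ?u)"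
      using spd A u orthogonal_mat_col(3)[OF U(1,2) k] by (simp add: spd_def)
    also have "\<dots> = (\<Sum>i<n. d i * (unit_vec n k $ i * unit_vec n k $ i))"
      unfolding A_eq quad[OF u] Uu ..
    also have "\<dots> = (\<Sum>i<n. if i = k then d i else 0)" using k by (intro sum.cong) auto
    also have "\<dots> = d k" using k by simp
    finally show ?thesis .
  qed
  define R where "R = mat_diag n (\<lambda>i. sqrt (d i))"
  define S where "S = U * R * transpose_mat U"
  have R: "R \<in> carrier_mat n n" by (simp add: R_def)
  have S: "S \<in> carrier_mat n n" unfolding S_def using U R by (intro mult_carrier_mat[of _ n n]) auto
  have RR: "R * R = mat_diag n d"
    unfolding R_def mat_diag_mult_left[OF mat_diag_dim] using d_pos
    by (intro eq_matI) (auto simp: mat_diag_def less_imp_le)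
  have RT: "transpose_mat R = R" unfolding R_def by (rule eq_matI) (auto simp: mat_diag_def)
  have "S * S = U * R * (transpose_mat U * U) * R * transpose_mat U"
    unfolding S_def using U(1) R by (simp add: assoc)
  also have "\<dots> = U * (R * R) * transpose_mat U" unfolding U(2) using U(1) R by (simp add: assoc)
  finally have "S * S = A" using A_eq RR by simp
  moreover have "transpose_mat S = S"
    unfolding S_def using U R RT by (simp add: transpose_mult[of _ n n _ n] assoc)
  moreover have "0 < v \<bullet> (S *\<^sub>v v)" if v: "v \<in> carrier_vec n" "v \<noteq> 0\<^sub>v n" for v
  proof -
    let ?w = "transpose_mat U *\<^sub>v v"
    have w: "?w \<in> carrier_vec n" using U v by simp
    have "U *\<^sub>v ?w = v" using U v by (simp flip: assoc_mult_mat_vec[of _ n n _ n])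
    then have "?w \<noteq> 0\<^sub>v n" using v(2) mult_mat_zero_vec[OF U(1)] by auto
    then obtain k where k: "k < n" "?w $ k \<noteq> 0" using w by (metis eq_vecI carrier_vecD index_zero_vec)
    show ?thesis unfolding S_def R_def quad[OF v(1)]
    proof (rule sum_pos2[of _ k])
      show "0 < sqrt (d k) * (?w $ k * ?w $ k)"
        using k d_pos[OF k(1)] by (auto simp: zero_less_mult_iff)
    qed (use k d_pos in \<open>auto simp: less_imp_le\<close>)
  qed
  ultimately show ?thesis using S by (auto simp: spd_def)
qed

text \<open>Each diagonal entry in the spectral decomposition is an eigenvalue, with a column of
  \<open>U\<close> as its eigenvector. If all of them vanish, so does the matrix.\<close>

lemma symmetric_mat_eq_0I:
  fixes X :: "real mat"
  assumes X: "X \<in> carrier_mat n n" and sym: "transpose_mat X = X"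
    and eig: "\<And>v e. v \<in> carrier_vec n \<Longrightarrow> v \<noteq> 0\<^sub>v n \<Longrightarrow> X *\<^sub>v v = e \<cdot>\<^sub>v v \<Longrightarrow> e = 0"
  shows "X = 0\<^sub>m n n"
proof -
  obtain U d where U: "U \<in> carrier_mat n n" "transpose_mat U * U = 1\<^sub>m n" "U * transpose_mat U = 1\<^sub>m n"
    and X_eq: "X = U * mat_diag n d * transpose_mat U"
    using real_spectral_theorem[OF X sym] by blast
  have "d k = 0" if k: "k < n" for k
  proof (rule eig)
    show "col U k \<in> carrier_vec n" "col U k \<noteq> 0\<^sub>v n" using orthogonal_mat_col[OF U(1,2) k] by auto
    have "X * U = U * mat_diag n d * (transpose_mat U * U)"
      unfolding X_eq using U(1) by (intro assoc_mult_mat[of _ n n _ n _ n]) auto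
    then have XU: "X * U = U * mat_diag n d"
      using U right_mult_one_mat[OF mult_carrier_mat[OF U(1) mat_diag_dim]] by simp
    have "X *\<^sub>v col U k = col (X * U) k" using X U k col_mult2[of X n n U n] by simp
    also have "\<dots> = d k \<cdot>\<^sub>v col U k" unfolding XU mat_diag_mult_right[OF U(1)]
      using U k by (intro eq_vecI) auto
    finally show "X *\<^sub>v col U k = d k \<cdot>\<^sub>v col U k" .
  qed
  then have "mat_diag n d = 0\<^sub>m n n" by (intro eq_matI) (auto simp: mat_diag_def)
  then show ?thesis unfolding X_eq using U by simp
qed

lemma spd_sqrt_unique:
  assumes S: "S \<in> carrier_mat n n" "spd S" and R: "R \<in> carrier_mat n n" "spd R"
    and eq: "S * S = R * R"
  shows "S = R"
proof -
  define X where "X = S - R"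
  have X: "X \<in> carrier_mat n n" unfolding X_def by (rule minus_carrier_mat[OF R(1)])
  have symX: "transpose_mat X = X"
    using S R by (simp add: X_def transpose_minus[of _ n n] spd_def)
  \<comment> \<open>\<open>S X + X R = S\<^sup>2 - R\<^sup>2 = 0\<close>, so the forms of \<open>S\<close> and \<open>R\<close> at an eigenvector of \<open>X\<close> with
      non-zero eigenvalue would cancel.\<close>
  have "X = 0\<^sub>m n n"
  proof (rule symmetric_mat_eq_0I[OF X symX])
    fix v e assume v: "v \<in> carrier_vec n" "v \<noteq> 0\<^sub>v n" and e: "X *\<^sub>v v = e \<cdot>\<^sub>v v"
    have Sv: "S *\<^sub>v v \<in> carrier_vec n" and Rv: "R *\<^sub>v v \<in> carrier_vec n" using S R v by auto
    have SR: "S *\<^sub>v v = X *\<^sub>v v + R *\<^sub>v v"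
      unfolding X_def using S R v
      by (intro eq_vecI) (auto simp: minus_mult_distrib_mat_vec[of _ n n])
    have "S *\<^sub>v (S *\<^sub>v v) = R *\<^sub>v (R *\<^sub>v v)"
      using arg_cong[OF eq, of "\<lambda>M. M *\<^sub>v v"] S R v by (simp add: assoc_mult_mat_vec[of _ n n _ n])
    then have "(S *\<^sub>v v) \<bullet> (S *\<^sub>v v) = (R *\<^sub>v v) \<bullet> (R *\<^sub>v v)"
      using symmetric_scalar_prod_mult_mat_vec[OF S(1) _ v(1) Sv]
        symmetric_scalar_prod_mult_mat_vec[OF R(1) _ v(1) Rv] S(2) R(2) by (simp add: spd_def)
    \<comment> \<open>Both factors \<open>S v\<close> are replaced in turn by
      \<open>e v + R v\<close>; the term left over is the squared length of
      \<open>R v\<close>.\<close>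
    moreover have "(S *\<^sub>v v) \<bullet> (S *\<^sub>v v) - (R *\<^sub>v v) \<bullet> (R *\<^sub>v v) = e * (v \<bullet> (S *\<^sub>v v) + v \<bullet> (R *\<^sub>v v))"
    proof -
      have "(S *\<^sub>v v) \<bullet> (S *\<^sub>v v) = e * (v \<bullet> (S *\<^sub>v v)) + (R *\<^sub>v v) \<bullet> (S *\<^sub>v v)"
        by (subst (1) SR, unfold e) (use v Sv Rv in \<open>simp add: add_scalar_prod_distrib[of _ n]\<close>)
      moreover have "(R *\<^sub>v v) \<bullet> (S *\<^sub>v v) = e * (v \<bullet> (R *\<^sub>v v)) + (R *\<^sub>v v) \<bullet> (R *\<^sub>v v)"
        by (subst SR, unfold e) (use v Rv comm_scalar_prod[OF v(1) Rv] in
          \<open>simp add: scalar_prod_add_distrib[of _ n]\<close>)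
      ultimately show ?thesis by (simp add: algebra_simps)
    qed
    moreover have "v \<bullet> (S *\<^sub>v v) > 0" "v \<bullet> (R *\<^sub>v v) > 0"
      using S R v by (auto simp: spd_def)
    ultimately show "e = 0" by auto
  qed
  have "S $$ (i, j) = R $$ (i, j)" if "i < n" "j < n" for i j
  proof -
    have "(S - R) $$ (i, j) = 0" using \<open>X = 0\<^sub>m n n\<close> that unfolding X_def by simp
    then show ?thesis using that R(1) by simp
  qed
  then show ?thesis using S R by (intro eq_matI) auto
qed

text \<open>Existence and uniqueness make the definite description in \<open>mat_sqrt\<close> denote
  the positive definite root.\<close>

lemma mat_sqrt:
  assumes "A \<in> carrier_mat n n" "spd A"
  shows "mat_sqrt A \<in> carrier_mat n n" "spd (mat_sqrt A)" "mat_sqrt A * mat_sqrt A = A"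
proof -
  obtain S where S: "S \<in> carrier_mat n n" "spd S" "S * S = A" using spd_sqrt_exists[OF assms] by blast
  have "mat_sqrt A = S"
    unfolding mat_sqrt_def
  proof (rule the_equality)
    fix R assume R: "spd R \<and> R * R = A"
    \<comment> \<open>The description ranges over matrices of all sizes; a square \<open>R\<close>
      with \<open>R * R = A\<close> must have the size of \<open>A\<close>.\<close>
    then have "R \<in> carrier_mat n n"
      using assms(1) by (metis carrier_matD(1) carrier_matI index_mult_mat(2) spd_def square_mat.simps)
    then show "R = S" using R S spd_sqrt_unique by metis
  qed (use S in simp)
  then show "mat_sqrt A \<in> carrier_mat n n" "spd (mat_sqrt A)" "mat_sqrt A * mat_sqrt A = A"
    using S by auto
qed

section \<open>The Euclidean norm and the induced spectral norm\<close>

lemma euclid_norm_nonneg: "euclid_norm v \<ge> 0"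
  by (simp add: euclid_norm_def scalar_prod_self_nonneg)

lemma euclid_norm_power2: "(euclid_norm v)\<^sup>2 = v \<bullet> v"
  by (simp add: euclid_norm_def scalar_prod_self_nonneg)

lemma euclid_norm_pos:
  assumes "v \<in> carrier_vec n" "v \<noteq> 0\<^sub>v n"
  shows "euclid_norm v > 0"
  using scalar_prod_self_pos[OF assms] by (simp add: euclid_norm_def)

lemma scalar_prod_Cauchy_Schwarz_power2:
  fixes v w :: "real vec"
  assumes v: "v \<in> carrier_vec n" and w: "w \<in> carrier_vec n"
  shows "(v \<bullet> w)\<^sup>2 \<le> (v \<bullet> v) * (w \<bullet> w)"
proof (cases "w = 0\<^sub>v n")
  case True
  then show ?thesis using v by simp
next
  case False
  then have pos: "w \<bullet> w > 0" using scalar_prod_self_pos[OF w] by simp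
  \<comment> \<open>Up to the factor \<open>w \<bullet> w\<close>, which avoids a division, this is
    the component of \<open>v\<close> orthogonal to \<open>w\<close>.\<close>
  let ?u = "(w \<bullet> w) \<cdot>\<^sub>v v - (v \<bullet> w) \<cdot>\<^sub>v w"
  have "?u \<bullet> ?u = (w \<bullet> w) * ((v \<bullet> v) * (w \<bullet> w) - (v \<bullet> w)\<^sup>2)"
    using v w comm_scalar_prod[OF v w]
    by (simp add: minus_scalar_prod_distrib[of _ n] scalar_prod_minus_distrib[of _ n]
        power2_eq_square algebra_simps)
  then have "0 \<le> (w \<bullet> w) * ((v \<bullet> v) * (w \<bullet> w) - (v \<bullet> w)\<^sup>2)"
    using scalar_prod_self_nonneg[of ?u] by simp
  then show ?thesis using pos by (simp add: zero_le_mult_iff)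
qed

lemma scalar_prod_le_euclid_norm:
  assumes "v \<in> carrier_vec n" "w \<in> carrier_vec n"
  shows "v \<bullet> w \<le> euclid_norm v * euclid_norm w"
proof (rule power2_le_imp_le)
  show "(v \<bullet> w)\<^sup>2 \<le> (euclid_norm v * euclid_norm w)\<^sup>2"
    using scalar_prod_Cauchy_Schwarz_power2[OF assms]
    by (simp add: power_mult_distrib euclid_norm_power2)
qed (simp add: euclid_norm_nonneg)

text \<open>Cauchy-Schwarz row by row. The Frobenius norm is a crude bound, but it is independent of
  \<open>v\<close>, so the quotients whose supremum is \<open>spectral_norm\<close> are bounded
  above; on the reals each quotient is then at most the supremum.\<close>

lemma euclid_norm_mult_mat_vec_le_frobenius:
  assumes B: "B \<in> carrier_mat m n" and v: "v \<in> carrier_vec n"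
  shows "euclid_norm (B *\<^sub>v v) \<le> sqrt (\<Sum>i<m. row B i \<bullet> row B i) * euclid_norm v"
proof -
  have "(B *\<^sub>v v) \<bullet> (B *\<^sub>v v) = (\<Sum>i<m. (row B i \<bullet> v)\<^sup>2)"
    using B by (simp add: scalar_prod_def[of "B *\<^sub>v v"] atLeast0LessThan power2_eq_square)
  also have "\<dots> \<le> (\<Sum>i<m. (row B i \<bullet> row B i) * (v \<bullet> v))"
    using B v by (intro sum_mono scalar_prod_Cauchy_Schwarz_power2) auto
  finally show ?thesis
    by (simp add: euclid_norm_def sum_distrib_right real_sqrt_mult[symmetric])
qed

lemma bdd_above_spectral_quotients:
  "bdd_above ((\<lambda>v. euclid_norm (B *\<^sub>v v) / euclid_norm v) `
     {v \<in> carrier_vec (dim_col B). v \<noteq> 0\<^sub>v (dim_col B)})"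
proof (rule bdd_aboveI2)
  fix v :: "real vec" assume "v \<in> {v \<in> carrier_vec (dim_col B). v \<noteq> 0\<^sub>v (dim_col B)}"
  then have v: "v \<in> carrier_vec (dim_col B)" "v \<noteq> 0\<^sub>v (dim_col B)" by auto
  have B: "B \<in> carrier_mat (dim_row B) (dim_col B)" by (rule carrier_matI) (rule refl)+
  show "euclid_norm (B *\<^sub>v v) / euclid_norm v \<le> sqrt (\<Sum>i<dim_row B. row B i \<bullet> row B i)"
    unfolding pos_divide_le_eq[OF euclid_norm_pos[OF v]]
    by (rule euclid_norm_mult_mat_vec_le_frobenius[OF B v(1)])
qed

lemma euclid_norm_quotient_le_spectral_norm:
  assumes "B \<in> carrier_mat m n" "v \<in> carrier_vec n" "v \<noteq> 0\<^sub>v n"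
  shows "euclid_norm (B *\<^sub>v v) / euclid_norm v \<le> spectral_norm B"
  unfolding spectral_norm_def induced_norm_def
  using bdd_above_spectral_quotients[of B] assms by (intro cSUP_upper) auto

lemma euclid_norm_mult_mat_vec_le:
  assumes B: "B \<in> carrier_mat m n" and v: "v \<in> carrier_vec n"
  shows "euclid_norm (B *\<^sub>v v) \<le> spectral_norm B * euclid_norm v"
proof (cases "v = 0\<^sub>v n")
  case True
  then show ?thesis using mult_mat_zero_vec[OF B] by (simp add: euclid_norm_def)
next
  case False
  then show ?thesis
    using euclid_norm_quotient_le_spectral_norm[OF B v] euclid_norm_pos[OF v]
    by (simp add: pos_divide_le_eq)
qed

text \<open>The supremum dominates the non-negative quotient at a unit vector. For
  \<open>n = 0\<close> it ranges over the empty set and its value is unspecified, so dimension 0 is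
  treated separately wherever this sign is needed.\<close>

lemma spectral_norm_nonneg:
  assumes "B \<in> carrier_mat m n" "n > 0"
  shows "spectral_norm B \<ge> 0"
proof -
  have "0 \<le> euclid_norm (B *\<^sub>v unit_vec n 0) / euclid_norm (unit_vec n 0)"
    by (simp add: euclid_norm_nonneg)
  also have "\<dots> \<le> spectral_norm B"
    using assms by (intro euclid_norm_quotient_le_spectral_norm) auto
  finally show ?thesis .
qed

section \<open>Energy norms, inverses and residuals\<close>

lemma spd_scalar_prod_mult_mat_vec:
  assumes "A \<in> carrier_mat n n" "spd A" "v \<in> carrier_vec n" "w \<in> carrier_vec n"
  shows "(A *\<^sub>v v) \<bullet> w = v \<bullet> (A *\<^sub>v w)"
  using assms by (intro symmetric_scalar_prod_mult_mat_vec[of A n]) (auto simp: spd_def)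

lemma energy_norm_power2:
  assumes A: "A \<in> carrier_mat n n" "spd A" and v: "v \<in> carrier_vec n"
  shows "(energy_norm A v)\<^sup>2 = v \<bullet> (A *\<^sub>v v)"
proof -
  note S = mat_sqrt[OF A]
  have "(energy_norm A v)\<^sup>2 = (mat_sqrt A *\<^sub>v v) \<bullet> (mat_sqrt A *\<^sub>v v)"
    by (simp add: energy_norm_def euclid_norm_power2)
  also have "\<dots> = v \<bullet> (mat_sqrt A *\<^sub>v (mat_sqrt A *\<^sub>v v))"
    using S v by (intro spd_scalar_prod_mult_mat_vec) auto
  also have "mat_sqrt A *\<^sub>v (mat_sqrt A *\<^sub>v v) = A *\<^sub>v v"
    using S v by (metis assoc_mult_mat_vec)
  finally show ?thesis .
qed

lemma energy_norm_nonneg: "energy_norm A v \<ge> 0"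
  by (simp add: energy_norm_def euclid_norm_nonneg)

text \<open>With \<open>s = mat_sqrt A *\<^sub>v v\<close>, the squared norm of \<open>A v\<close>
  is \<open>s \<bullet> A s\<close>, at most \<open>spectral_norm A\<close> times the squared norm
  of \<open>s\<close>, and the norm of \<open>s\<close> is the energy norm of \<open>v\<close>. The
  spectral norm of the root itself never has to be computed.\<close>

lemma euclid_norm_mult_mat_vec_le_energy_norm:
  assumes A: "A \<in> carrier_mat n n" "spd A" and v: "v \<in> carrier_vec n"
  shows "euclid_norm (A *\<^sub>v v) \<le> sqrt (spectral_norm A) * energy_norm A v"
\<comment> \<open>In dimension 0 both sides vanish, whatever the unspecified value of
  \<open>spectral_norm A\<close>.\<close>
proof (cases "n = 0")
  case True
  then have "A *\<^sub>v v = 0\<^sub>v 0" using A v by auto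
  then show ?thesis using True v
    by (simp add: euclid_norm_def energy_norm_def scalar_prod_def mat_sqrt[OF A] True)
next
  case False
  note S = mat_sqrt[OF A]
  let ?s = "mat_sqrt A *\<^sub>v v"
  have s: "?s \<in> carrier_vec n" using S v by simp
  have Av: "A *\<^sub>v v = mat_sqrt A *\<^sub>v ?s" using S v by (metis assoc_mult_mat_vec)
  have "(euclid_norm (A *\<^sub>v v))\<^sup>2 = ?s \<bullet> (A *\<^sub>v ?s)"
    unfolding euclid_norm_power2 Av using S s
    by (metis assoc_mult_mat_vec mult_mat_vec_carrier spd_scalar_prod_mult_mat_vec)
  also have "\<dots> \<le> euclid_norm ?s * euclid_norm (A *\<^sub>v ?s)"
    using A s by (intro scalar_prod_le_euclid_norm[of _ n]) auto
  also have "\<dots> \<le> euclid_norm ?s * (spectral_norm A * euclid_norm ?s)"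
    using A s by (intro mult_left_mono euclid_norm_mult_mat_vec_le euclid_norm_nonneg)
  also have "\<dots> = (sqrt (spectral_norm A) * energy_norm A v)\<^sup>2"
    using spectral_norm_nonneg[OF A(1)] False
    by (simp add: energy_norm_def power_mult_distrib power2_eq_square ac_simps)
  finally show ?thesis
    by (rule power2_le_imp_le)
      (use spectral_norm_nonneg[OF A(1)] False energy_norm_nonneg in simp)
qed

lemma spd_kernel:
  assumes "A \<in> carrier_mat n n" "spd A" "v \<in> carrier_vec n" "A *\<^sub>v v = 0\<^sub>v n"
  shows "v = 0\<^sub>v n"
  using assms unfolding spd_def by (metis carrier_matD(1) less_irrefl scalar_prod_right_zero)

text \<open>A positive definite matrix has trivial kernel, hence non-zero determinant, so
  \<open>mat_inverse\<close> returns \<open>Some\<close> and \<open>mat_inv\<close> is a two-sided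
  inverse.\<close>

lemma spd_mat_inv:
  assumes A: "A \<in> carrier_mat n n" "spd A"
  shows "mat_inv A \<in> carrier_mat n n" "A * mat_inv A = 1\<^sub>m n" "mat_inv A * A = 1\<^sub>m n"
proof -
  have "det A \<noteq> 0"
    using det_0_iff_vec_prod_zero[OF A(1)] spd_kernel[OF A] by blast
  then have "A \<in> Units (ring_mat TYPE(real) n ())" by (rule det_non_zero_imp_unit[OF A(1)])
  then obtain B where "mat_inverse A = Some B" using mat_inverse(1)[OF A(1), where b = "()"] by blast
  then show "mat_inv A \<in> carrier_mat n n" "A * mat_inv A = 1\<^sub>m n" "mat_inv A * A = 1\<^sub>m n"
    using mat_inverse(2)[OF A(1)] by auto
qed

text \<open>The error \<open>e\<close> and the residual \<open>r\<close> satisfy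
  \<open>A e = r\<close>, so the squared energy norm of \<open>e\<close> is
  \<open>e \<bullet> r\<close>. Writing \<open>e\<close> as the inverse applied to \<open>r\<close>
  and using Cauchy-Schwarz bounds it by the spectral norm of the inverse times the squared norm of
  \<open>r\<close>.\<close>

lemma energy_norm_error_le_residual:
  assumes A: "A \<in> carrier_mat n n" "spd A" and f: "f \<in> carrier_vec n" and v: "v \<in> carrier_vec n"
  shows "energy_norm A (mat_inv A *\<^sub>v f - v) \<le>
    sqrt (spectral_norm (mat_inv A)) * euclid_norm (f - A *\<^sub>v v)"
proof (cases "n = 0")
  case True
  then show ?thesis using mat_sqrt[OF A] spd_mat_inv[OF A] A f v
    by (simp add: euclid_norm_def energy_norm_def scalar_prod_def)
next
  case False
  note I = spd_mat_inv[OF A]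
  let ?e = "mat_inv A *\<^sub>v f - v"
  let ?r = "f - A *\<^sub>v v"
  have e: "?e \<in> carrier_vec n" using I f v by (intro minus_carrier_vec) auto
  have r: "?r \<in> carrier_vec n" using A v f by (intro minus_carrier_vec) auto
  have er: "?e = mat_inv A *\<^sub>v ?r"
  proof -
    have "mat_inv A *\<^sub>v (A *\<^sub>v v) = v" using I A v by (simp flip: assoc_mult_mat_vec[of _ n n _ n])
    then show ?thesis using I A f v by (simp add: mult_minus_distrib_mat_vec[of _ n n])
  qed
  have Ae: "A *\<^sub>v ?e = ?r" unfolding er using I A r by (simp flip: assoc_mult_mat_vec[of _ n n _ n])
  have "(energy_norm A ?e)\<^sup>2 = ?e \<bullet> ?r" using energy_norm_power2[OF A e] Ae by simp
  also have "\<dots> \<le> euclid_norm (mat_inv A *\<^sub>v ?r) * euclid_norm ?r"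
    using scalar_prod_le_euclid_norm[OF e r] er by simp
  also have "\<dots> \<le> (spectral_norm (mat_inv A) * euclid_norm ?r) * euclid_norm ?r"
    using I r by (intro mult_right_mono euclid_norm_mult_mat_vec_le euclid_norm_nonneg)
  also have "\<dots> = (sqrt (spectral_norm (mat_inv A)) * euclid_norm ?r)\<^sup>2"
    using spectral_norm_nonneg[OF I(1)] False by (simp add: power_mult_distrib power2_eq_square)
  finally show ?thesis
    by (rule power2_le_imp_le)
      (use spectral_norm_nonneg[OF I(1)] False euclid_norm_nonneg in simp)
qed

section \<open>Positive definiteness of the Galerkin matrices\<close>

text \<open>Linear independence is a property of the set of columns, so repeated columns must be
  excluded first: the rank is the size of a maximal independent subset of that set, and rank
  \<open>nc\<close> leaves no room for repetitions.\<close>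

lemma (in vec_space) full_rank_kernel:
  fixes B :: "'a mat"
  assumes B: "B \<in> carrier_mat n nc" and rank: "rank B = nc"
    and v: "v \<in> carrier_vec nc" "B *\<^sub>v v = 0\<^sub>v n"
  shows "v = 0\<^sub>v nc"
proof -
  obtain S where S: "maximal S (\<lambda>T. T \<subseteq> set (cols B) \<and> lin_indpt T)"
    using maximal_exists[of "(\<lambda>T. T \<subseteq> set (cols B) \<and> lin_indpt T)" "card (set (cols B))" "{}"]
    by (meson List.finite_set card_mono empty_iff empty_subsetI finite_lin_indpt2 rev_finite_subset)
  then have "nc \<le> card (set (cols B))"
    using rank_card_indpt[OF B S] rank by (simp add: card_mono maximal_def)
  then have distinct: "distinct (cols B)"
    using B card_length[of "cols B"] by (intro card_distinct) simp
  then have "lin_indpt (set (cols B))" by (rule full_rank_lin_indpt[OF B rank])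
  then show ?thesis using lin_depI[OF B v(1) _ v(2) distinct] by blast
qed

text \<open>The form of the coarse matrix at \<open>v\<close> is the form of \<open>A\<close> at
  \<open>P v\<close>, and \<open>P v\<close> is non-zero for non-zero \<open>v\<close> by full
  column rank.\<close>

lemma spd_galerkin:
  assumes A: "A \<in> carrier_mat n n" "spd A" and P: "P \<in> carrier_mat n m"
    and rank: "vec_space.rank n P = m"
  shows "spd (transpose_mat P * A * P)"
proof -
  have PAP: "transpose_mat P * A * P \<in> carrier_mat m m" using A P by simp
  have sym: "transpose_mat A = A" using A(2) by (simp add: spd_def)
  have "transpose_mat (transpose_mat P * A * P) = transpose_mat P * A * P"
  proof -
    have "transpose_mat (transpose_mat P * A * P) = transpose_mat P * transpose_mat (transpose_mat P * A)"
      using A(1) P by (intro transpose_mult) auto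
    also have "transpose_mat (transpose_mat P * A) = A * P"
      using transpose_mult[of "transpose_mat P" m n A n] A(1) P sym by simp
    finally show ?thesis using A(1) P by (simp add: assoc_mult_mat[of _ m n _ n _ m])
  qed
  moreover have "v \<bullet> ((transpose_mat P * A * P) *\<^sub>v v) > 0"
    if v: "v \<in> carrier_vec m" "v \<noteq> 0\<^sub>v m" for v
  proof -
    have Pv: "P *\<^sub>v v \<in> carrier_vec n" using P v by simp
    have "P *\<^sub>v v \<noteq> 0\<^sub>v n" using vec_space.full_rank_kernel[OF P rank v(1)] v(2) by blast
    then have "0 < (P *\<^sub>v v) \<bullet> (A *\<^sub>v (P *\<^sub>v v))" using A Pv by (simp add: spd_def)
    also have "\<dots> = v \<bullet> (transpose_mat P *\<^sub>v (A *\<^sub>v (P *\<^sub>v v)))"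
      using transpose_vec_mult_scalar[of "transpose_mat P" m n "A *\<^sub>v (P *\<^sub>v v)" v] A P v Pv
      by simp
    also have "transpose_mat P *\<^sub>v (A *\<^sub>v (P *\<^sub>v v)) = (transpose_mat P * A * P) *\<^sub>v v"
      using A P v by (simp add: assoc_mult_mat_vec[of _ m n _ m] assoc_mult_mat_vec[of _ m n _ n])
    finally show ?thesis .
  qed
  ultimately show ?thesis using PAP by (auto simp: spd_def)
qed

section \<open>The matrix \<open>T\<close> and the right-hand side on the coarsest level\<close>

lemma T_mat_carrier:
  assumes "\<And>i. i \<le> j \<Longrightarrow> A i \<in> carrier_mat (n i) (n i)"
    and "\<And>i. i < j \<Longrightarrow> P (Suc i) \<in> carrier_mat (n (Suc i)) (n i)"
    and "\<And>i. i < j \<Longrightarrow> M (Suc i) \<in> carrier_mat (n (Suc i)) (n (Suc i))"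
  shows "T_mat A P M j \<in> carrier_mat (n 0) (n j)"
  using assms
proof (induction j)
  case 0
  then show ?case by simp
next
  case (Suc j)
  have "T_mat A P M j \<in> carrier_mat (n 0) (n j)" using Suc by simp
  moreover have "transpose_mat (P (Suc j)) \<in> carrier_mat (n j) (n (Suc j))"
    using Suc.prems(2) by simp
  moreover have "1\<^sub>m (dim_row (A (Suc j))) - A (Suc j) * M (Suc j) \<in> carrier_mat (n (Suc j)) (n (Suc j))"
    using Suc.prems(1)[of "Suc j"] Suc.prems(3)[of j] by (intro minus_carrier_mat) simp
  ultimately show ?case by simp
qed

lemma inV_cycle_coarsest_carrier:
  assumes "inV_cycle A P M N j f v f0 v0in w"
  shows "v0in \<in> carrier_vec (dim_row (A 0))"
  using assms by induction auto

text \<open>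
  At level \<open>0\<close> the V-cycle passes down its right-hand side rather than the residual; the two agree
  for the zero initial approximation used in all recursive calls.
\<close>

lemma inV_cycle_coarsest_rhs:
  assumes "inV_cycle A P M N j f v f0 v0in w"
    and "\<And>i. i \<le> j \<Longrightarrow> A i \<in> carrier_mat (n i) (n i)"
    and "\<And>i. i < j \<Longrightarrow> P (Suc i) \<in> carrier_mat (n (Suc i)) (n i)"
    and "\<And>i. i < j \<Longrightarrow> M (Suc i) \<in> carrier_mat (n (Suc i)) (n (Suc i))"
    and "f \<in> carrier_vec (n j)" "v \<in> carrier_vec (n j)" "j = 0 \<Longrightarrow> v = 0\<^sub>v (n 0)"
  shows "f0 = T_mat A P M j *\<^sub>v (f - A j *\<^sub>v v)"
  using assms
proof induction
  case (coarsest v0in f v)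
  have "A 0 *\<^sub>v v = 0\<^sub>v (n 0)" using coarsest mult_mat_zero_vec[of "A 0" "n 0" "n 0"] by simp
  then show ?case using coarsest by simp
next
  case (level v1 v j f f' f0 v0in v2 v3 v4)
  let ?A = "A (Suc j)" and ?M = "M (Suc j)" and ?PT = "transpose_mat (P (Suc j))"
  let ?n = "n (Suc j)"
  let ?g = "f - ?A *\<^sub>v v"
  have A: "?A \<in> carrier_mat ?n ?n" and Aj: "A j \<in> carrier_mat (n j) (n j)"
    and PT: "?PT \<in> carrier_mat (n j) ?n" and M: "?M \<in> carrier_mat ?n ?n"
    and f: "f \<in> carrier_vec ?n" and v: "v \<in> carrier_vec ?n"
    using level.prems by auto
  have T: "T_mat A P M j \<in> carrier_mat (n 0) (n j)"
    using level.prems by (intro T_mat_carrier) auto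
  have g: "?g \<in> carrier_vec ?n" using A f v by simp
  have E: "1\<^sub>m ?n - ?A * ?M \<in> carrier_mat ?n ?n" using A M by (intro minus_carrier_mat) simp
  \<comment> \<open>Pre-smoothing multiplies the residual by \<open>I - A M\<close>; restriction by
    the transposed prolongation then gives one factor of \<open>T_mat\<close>.\<close>
  have "f - ?A *\<^sub>v v1 = ?g - ?A *\<^sub>v (?M *\<^sub>v ?g)"
    unfolding level.hyps(1) using A M f v g
    by (intro eq_vecI) (auto simp: mult_add_distrib_mat_vec[of _ ?n ?n])
  also have "\<dots> = (1\<^sub>m ?n - ?A * ?M) *\<^sub>v ?g"
    using A M g by (simp add: minus_mult_distrib_mat_vec[of _ ?n ?n] assoc_mult_mat_vec[of _ ?n ?n _ ?n])
  finally have f': "f' = ?PT *\<^sub>v ((1\<^sub>m ?n - ?A * ?M) *\<^sub>v ?g)" using level.hyps(2) by simp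
  have f'c: "f' \<in> carrier_vec (n j)" unfolding f' using PT E g by simp
  \<comment> \<open>The recursive call starts from zero, so the initial residual in the induction
    hypothesis is \<open>f'\<close> itself.\<close>
  have "f0 = T_mat A P M j *\<^sub>v (f' - A j *\<^sub>v 0\<^sub>v (dim_row (A j)))"
    using level.prems f'c Aj by (intro level.IH) (use carrier_matD(1)[OF Aj] in auto)
  also have "f' - A j *\<^sub>v 0\<^sub>v (dim_row (A j)) = f'"
    using mult_mat_zero_vec[OF Aj] Aj f'c by simp
  finally show ?case
    unfolding f' using T PT E g A
    by (simp add: assoc_mult_mat_vec[of _ "n 0" "n j" _ ?n] assoc_mult_mat_vec[of _ "n j" ?n _ ?n])
qed

theorem mainTheorem3:
  fixes J :: nat and n :: "nat \<Rightarrow> nat"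
    and A P M N :: "nat \<Rightarrow> real mat"
    and b x xprev xnew f0 v0 v0in :: "real vec"
    and \<tau> \<gamma> :: real
  assumes levels: "1 \<le> J"
    and dim_A: "\<And>j. j \<le> J \<Longrightarrow> A j \<in> carrier_mat (n j) (n j)"
    and spd_A: "spd (A J)"
    and dim_P: "\<And>j. 1 \<le> j \<Longrightarrow> j \<le> J \<Longrightarrow> P j \<in> carrier_mat (n j) (n (j - 1))"
    and full_rank_P: "\<And>j. 1 \<le> j \<Longrightarrow> j \<le> J \<Longrightarrow>
      vec_space.rank (n j) (P j) = n (j - 1)"
    and galerkin: "\<And>j. 1 \<le> j \<Longrightarrow> j \<le> J \<Longrightarrow>
      A (j - 1) = transpose_mat (P j) * A j * P j"
    and smoothers:
      "(\<forall>j\<in>{1..J}. convergent_smoother (A j) (M j)) \<and>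
         (\<forall>j\<in>{1..J}. convergent_smoother (A j) (N j)) \<or>
       (\<forall>j\<in>{1..J}. M j = 0\<^sub>m (n j) (n j)) \<and>
         (\<forall>j\<in>{1..J}. convergent_smoother (A j) (N j)) \<or>
       (\<forall>j\<in>{1..J}. convergent_smoother (A j) (M j)) \<and>
         (\<forall>j\<in>{1..J}. N j = 0\<^sub>m (n j) (n j))"
    and dim_b: "b \<in> carrier_vec (n J)"
    and x_def: "x = mat_inv (A J) *\<^sub>v b"
    and dim_xprev: "xprev \<in> carrier_vec (n J)"
    and cycle: "inV_cycle A P M N J b xprev f0 v0in xnew"
    and f0_nonzero: "f0 \<noteq> 0\<^sub>v (n 0)"
    and v0_def: "v0 = mat_inv (A 0) *\<^sub>v f0"
    and tau_pos: "\<tau> > 0"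
    and stopping: "euclid_norm (f0 - A 0 *\<^sub>v v0in) / euclid_norm f0 \<le> \<tau>"
    and gamma_def: "\<gamma> = \<tau> * spectral_norm (T_mat A P M J) * sqrt (spectral_norm (A J)) *
      sqrt (spectral_norm (mat_inv (A 0)))"
  shows "energy_norm (A 0) (v0 - v0in) \<le> \<gamma> * energy_norm (A J) (x - xprev)"
proof -
  have P: "P (Suc i) \<in> carrier_mat (n (Suc i)) (n i)" if "i < J" for i
    using dim_P[of "Suc i"] that by simp
  \<comment> \<open>Under each of the three smoothing alternatives \<open>M\<close> is zero or a
    convergent smoother, and either determines its dimensions.\<close>
  have M: "M (Suc i) \<in> carrier_mat (n (Suc i)) (n (Suc i))" if "i < J" for i
  proof -
    have "Suc i \<in> {1..J}" using that by simp
    then have "M (Suc i) = 0\<^sub>m (n (Suc i)) (n (Suc i)) \<or> convergent_smoother (A (Suc i)) (M (Suc i))"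
      using smoothers by blast
    then show ?thesis using dim_A[of "Suc i"] that by (auto simp: convergent_smoother_def)
  qed
  \<comment> \<open>The Galerkin condition passes positive definiteness from a level to the next
    coarser one, so the induction runs downwards from \<open>J\<close>, with \<open>k\<close>
    counting the levels descended.\<close>
  have spd: "spd (A (J - k))" if "k \<le> J" for k
    using that
  proof (induction k)
    case 0
    show ?case using spd_A by simp
  next
    case (Suc k)
    then have k: "1 \<le> J - k" "J - k \<le> J" "J - k - 1 = J - Suc k" by auto
    show ?case
      using galerkin[OF k(1,2)] full_rank_P[OF k(1,2)] dim_P[OF k(1,2)] dim_A[OF k(2)] Suc
      unfolding k(3) by (metis Suc_leD spd_galerkin)
  qed
  have spd0: "spd (A 0)" using spd[of J] by simp
  have A0: "A 0 \<in> carrier_mat (n 0) (n 0)" and AJ: "A J \<in> carrier_mat (n J) (n J)"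
    using dim_A by auto
  have T: "T_mat A P M J \<in> carrier_mat (n 0) (n J)"
    using dim_A P M by (rule T_mat_carrier)
  have v0in: "v0in \<in> carrier_vec (n 0)" using inV_cycle_coarsest_carrier[OF cycle] A0 by simp
  have f0: "f0 = T_mat A P M J *\<^sub>v (b - A J *\<^sub>v xprev)"
    using cycle dim_A P M dim_b dim_xprev levels by (intro inV_cycle_coarsest_rhs) auto
  have f0c: "f0 \<in> carrier_vec (n 0)" unfolding f0 using T AJ dim_b dim_xprev by simp
  \<comment> \<open>An empty finest level would give \<open>f0\<close> the value zero. Hence the
    supremum in the norm of \<open>T\<close> is over a non-empty set and the norm is non-negative,
    as needed when multiplying inequalities by it.\<close>
  have nJ: "n J > 0"
  proof (rule ccontr)
    assume "\<not> n J > 0"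
    then have "b - A J *\<^sub>v xprev = 0\<^sub>v (n J)" using dim_b AJ by auto
    then show False using f0 f0_nonzero mult_mat_zero_vec[OF T] by simp
  qed
  have n0: "n 0 > 0" using f0c f0_nonzero by (cases "n 0") auto
  note I = spd_mat_inv[OF AJ spd_A]
  have xc: "x \<in> carrier_vec (n J)" unfolding x_def using I dim_b by simp
  have "A J *\<^sub>v x = b"
    unfolding x_def using I AJ dim_b by (simp flip: assoc_mult_mat_vec[of _ "n J" "n J" _ "n J"])
  \<comment> \<open>The initial residual is \<open>A\<close> applied to the initial error, which
    brings in the energy norm of \<open>x - xprev\<close>.\<close>
  then have res: "b - A J *\<^sub>v xprev = A J *\<^sub>v (x - xprev)"
    using mult_minus_distrib_mat_vec[OF AJ xc dim_xprev] by simp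
  have err: "x - xprev \<in> carrier_vec (n J)" using xc dim_xprev by simp
  have "euclid_norm f0 \<le> spectral_norm (T_mat A P M J) * euclid_norm (A J *\<^sub>v (x - xprev))"
    unfolding f0 res using T AJ err by (intro euclid_norm_mult_mat_vec_le) auto
  also have "\<dots> \<le> spectral_norm (T_mat A P M J) *
      (sqrt (spectral_norm (A J)) * energy_norm (A J) (x - xprev))"
    using euclid_norm_mult_mat_vec_le_energy_norm[OF AJ spd_A err] spectral_norm_nonneg[OF T nJ]
    by (rule mult_left_mono)
  finally have f0_le: "euclid_norm f0 \<le> spectral_norm (T_mat A P M J) *
      (sqrt (spectral_norm (A J)) * energy_norm (A J) (x - xprev))" .
  \<comment> \<open>The quotient in the stopping criterion can be cleared because \<open>f0\<close>
    is non-zero.\<close>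
  have "euclid_norm (f0 - A 0 *\<^sub>v v0in) \<le> \<tau> * euclid_norm f0"
    using stopping euclid_norm_pos[OF f0c f0_nonzero] by (simp add: pos_divide_le_eq)
  also have "\<dots> \<le> \<tau> * (spectral_norm (T_mat A P M J) *
      (sqrt (spectral_norm (A J)) * energy_norm (A J) (x - xprev)))"
    using f0_le tau_pos by simp
  finally have res_le: "euclid_norm (f0 - A 0 *\<^sub>v v0in) \<le> \<tau> * (spectral_norm (T_mat A P M J) *
      (sqrt (spectral_norm (A J)) * energy_norm (A J) (x - xprev)))" .
  have "energy_norm (A 0) (v0 - v0in) \<le>
      sqrt (spectral_norm (mat_inv (A 0))) * euclid_norm (f0 - A 0 *\<^sub>v v0in)"
    unfolding v0_def by (rule energy_norm_error_le_residual[OF A0 spd0 f0c v0in])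
  also have "\<dots> \<le> sqrt (spectral_norm (mat_inv (A 0))) * (\<tau> * (spectral_norm (T_mat A P M J) *
      (sqrt (spectral_norm (A J)) * energy_norm (A J) (x - xprev))))"
    using res_le spectral_norm_nonneg[OF spd_mat_inv(1)[OF A0 spd0] n0] by (intro mult_left_mono) auto
  also have "\<dots> = \<gamma> * energy_norm (A J) (x - xprev)"
    unfolding gamma_def by (simp add: ac_simps)
  finally show ?thesis .
qed

end
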